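(* For every $p\in\mathbb{K}[X,Y]\setminus(\mathbb{K}[X]\cup\mathbb{K}[Y])$, the algebra $A(\langle p\rangle)$ is simple, i.e., generated by a single element as a unital $\mathbb{K}$-algebra.
   Context: $\mathbb{K}$ is a computable field of characteristic zero in which one can decide whether a given element is a root of unity. $X$ stands for the variables $x_1,\dots,x_n$ and $Y$ for $y_1,\dots,y_m$ ($n,m\ge 1$). For an ideal $I\subseteq\mathbb{K}[X,Y]$, $A(I):=\{(f,g)\in\mathbb{K}[X]\times\mathbb{K}[Y] : f-g\in I\}$, which is a unital $\mathbb{K}$-algebra with component-wise operations and unit $(1,1)$. Such an algebra is called simple if there is one element $(f,g)$ of it such that every element of the algebra has the form $(h(f),h(g))$ for some univariate polynomial $h$ over $\mathbb{K}$ (this includes the trivial algebra $\mathbb{K}\cdot(1,1)$). *)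

theory Defs
  imports "HOL-Library.Poly_Mapping" "HOL-Computational_Algebra.Polynomial"
begin

text \<open>
  Multivariate polynomials over \<open>'k\<close> in variables indexed by \<open>'v\<close>: finitely supported
  maps from monomials (exponent vectors) to coefficients, with convolution as product.
  For \<open>\<bbbK>[X,Y]\<close> we take the index type \<open>'n + 'm\<close> with \<open>'n\<close> and \<open>'m\<close> finite: \<open>Inl i\<close> stands
  for a variable of \<open>X\<close>, and \<open>Inr j\<close> for a variable of \<open>Y\<close>.
\<close>

type_synonym ('v, 'k) mpoly = "('v \<Rightarrow>\<^sub>0 nat) \<Rightarrow>\<^sub>0 'k"

definition const :: "'k::zero \<Rightarrow> ('v, 'k) mpoly" where
  "const c = Poly_Mapping.single 0 c"

definition vars :: "('v, 'k::zero) mpoly \<Rightarrow> 'v set" where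
  "vars p = (\<Union>t\<in>Poly_Mapping.keys p. Poly_Mapping.keys t)"

text \<open>\<open>\<bbbK>[X]\<close> and \<open>\<bbbK>[Y]\<close> as subrings of \<open>\<bbbK>[X,Y]\<close>:\<close>

definition polys_X :: "('n + 'm, 'k::zero) mpoly set" where
  "polys_X = {p. vars p \<subseteq> range Inl}"

definition polys_Y :: "('n + 'm, 'k::zero) mpoly set" where
  "polys_Y = {p. vars p \<subseteq> range Inr}"

text \<open>A commutative ring is a module over itself, and its ideals are the submodules.\<close>

definition ideal_gen :: "'a::comm_ring_1 set \<Rightarrow> 'a set" where
  "ideal_gen S = module.span (*) S"

lemma ideal_gen_singleton: "ideal_gen {p} = {q. p dvd q}"
proof -
  interpret module "(*) :: 'a \<Rightarrow> 'a \<Rightarrow> 'a"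
    by standard (simp_all add: algebra_simps)
  show ?thesis
    by (auto simp: ideal_gen_def span_singleton dvd_def mult.commute)
qed

definition sep_alg ::
  "('n + 'm, 'k::comm_ring_1) mpoly set \<Rightarrow> (('n + 'm, 'k) mpoly \<times> ('n + 'm, 'k) mpoly) set" where
  "sep_alg I = {(f, g). f \<in> polys_X \<and> g \<in> polys_Y \<and> f - g \<in> I}"

text \<open>\<open>h(f)\<close> for a univariate polynomial \<open>h\<close> over the field of coefficients.\<close>

definition eval_at :: "'k::comm_ring_1 poly \<Rightarrow> ('v, 'k) mpoly \<Rightarrow> ('v, 'k) mpoly" where
  "eval_at h f = poly (map_poly const h) f"

definition simple_alg :: "(('v, 'k::comm_ring_1) mpoly \<times> ('v, 'k) mpoly) set \<Rightarrow> bool" where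
  "simple_alg A \<longleftrightarrow>
     (\<exists>(f, g)\<in>A. \<forall>(u, v)\<in>A. \<exists>h. u = eval_at h f \<and> v = eval_at h g)"

end

theory Submission
  imports Defs "HOL-Library.Product_Lexorder" "HOL-Computational_Algebra.Polynomial_Factorial"
begin

text \<open>
  Write \<open>A\<close> for the algebra of separated multiples of \<open>p\<close>. Replacing the \<open>X\<close>-variables by suitable
  powers of one variable \<open>t\<close> keeps \<open>p\<close> outside \<open>K[Y]\<close>, so this substitution embeds \<open>A\<close>, through
  its first components, as a subalgebra \<open>B\<close> of \<open>K[t]\<close>.

  The algebra \<open>B\<close> contains every polynomial \<open>c\<close> in its field of fractions: there is a fixed nonzero
  \<open>d \<in> B\<close> with \<open>d * c ^ n \<in> B\<close> for all \<open>n\<close>, which lifts to both components of \<open>A\<close>; as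
  polynomial rings are completely integrally closed, the components of the fraction \<open>c\<close> are
  polynomials, and \<open>p\<close> divides their difference because no nonzero \<open>b \<in> K[X]\<close> can cancel part of
  \<open>p\<close> once \<open>A\<close> is not trivial.

  A polynomial version of the theorem of Lueroth then gives \<open>B = K[h]\<close>: the minimal polynomial \<open>\<phi>\<close> of
  \<open>t\<close> over the field of fractions of \<open>B\<close> has coefficients in \<open>B\<close>; if \<open>h\<close> is one of largest degree,
  comparing degrees in \<open>t\<close> shows that \<open>\<phi>\<close> is \<open>h(T) - h(t)\<close> up to a constant factor.
\<close>

section \<open>Univariate polynomials\<close>

lemma degree_diff_less_cancel:
  fixes p q :: "'a::ab_group_add poly"
  assumes "degree p = degree q" "lead_coeff p = lead_coeff q"
  shows "p - q = 0 \<or> degree (p - q) < degree p"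
proof (rule disjCI)
  assume *: "\<not> degree (p - q) < degree p"
  have "degree (p - q) \<le> degree p"
    using degree_diff_le[of p "degree p" q] assms by simp
  with * have "degree (p - q) = degree p" by simp
  then have "lead_coeff (p - q) = coeff p (degree p) - coeff q (degree q)" using assms by simp
  then have "lead_coeff (p - q) = 0" using assms by simp
  then show "p - q = 0" by (simp only: leading_coeff_0_iff)
qed

text \<open>A divisor of least degree among the non-units is irreducible, and over a field
  irreducible polynomials are prime.\<close>

lemma ex_prime_divisor_poly:
  fixes c :: "'k::field poly"
  assumes "c \<noteq> 0" "\<not> is_unit c"
  obtains \<pi> where "\<pi> dvd c" "prime_elem \<pi>"
proof -
  obtain \<pi> where \<pi>: "\<pi> dvd c" "\<not> is_unit \<pi>"
    and min: "\<And>a. a dvd c \<Longrightarrow> \<not> is_unit a \<Longrightarrow> degree \<pi> \<le> degree a"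
    using ex_has_least_nat[of "\<lambda>a. a dvd c \<and> \<not> is_unit a" c degree] assms by auto
  have \<pi>0: "\<pi> \<noteq> 0" using \<pi>(1) assms(1) by auto
  have "irreducible \<pi>"
  proof (rule irreducibleI[OF \<pi>0 \<pi>(2)], rule ccontr)
    fix a b assume ab: "\<pi> = a * b" "\<not> (is_unit a \<or> is_unit b)"
    then have "degree b \<noteq> 0" using \<pi>0 is_unit_iff_degree by auto
    then have "degree a < degree \<pi>" using ab \<pi>0 by (auto simp: degree_mult_eq)
    then show False using min[of a] ab \<pi>(1) by (auto dest: dvd_mult_left)
  qed
  then show ?thesis using \<pi>(1) field_poly_irreducible_imp_prime that by blast
qed

text \<open>A prime factor of \<open>c\<close> stays prime as a constant polynomial, so it divides
  \<open>U\<close> or \<open>V\<close> and can be stripped off; this ends with a unit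
  \<open>c\<close>, which the product of the two leading coefficients equals. It serves to make a
  minimal annihilating polynomial monic without leaving \<open>K[t]\<close>.\<close>

lemma gauss_proportional_monic:
  fixes U V W :: "'k::field poly poly"
  assumes "U * V = smult c W" "c \<noteq> 0" "lead_coeff W = 1"
  shows "\<exists>d U'. U = smult d U' \<and> lead_coeff U' = 1"
  using assms
proof (induction "degree c" arbitrary: c U V rule: less_induct)
  case less
  show ?case
  proof (cases "is_unit c")
    case True
    have "lead_coeff U * lead_coeff V = c"
      using less.prems by (metis lead_coeff_mult lead_coeff_smult mult.right_neutral)
    then have u: "is_unit (lead_coeff U)" using True by (metis dvd_mult_left)
    then obtain v where v: "lead_coeff U * v = 1" by (auto elim!: dvdE)
    have "U = smult (lead_coeff U) (smult v U)" using v by simp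
    moreover have "lead_coeff (smult v U) = 1" using v by (metis lead_coeff_smult mult.commute)
    ultimately show ?thesis by blast
  next
    case False
    then obtain \<pi> where \<pi>: "\<pi> dvd c" "prime_elem \<pi>"
      using ex_prime_divisor_poly less.prems(2) by blast
    then obtain c' where c': "c = \<pi> * c'" by (elim dvdE)
    have c0: "\<pi> \<noteq> 0" "c' \<noteq> 0" using less.prems(2) c' by auto
    have deg: "degree \<pi> > 0"
      using \<pi>(2) c0(1) by (metis is_unit_iff_degree neq0_conv prime_elem_not_unit)
    then have lt: "degree c' < degree c"
      using c' c0 by (simp add: degree_mult_eq)
    have pr: "prime_elem [:\<pi>:]" using \<pi>(2) by (rule lift_prime_elem_poly)
    have "U * V = [:\<pi>:] * smult c' W" using less.prems(1) c' by (simp add: mult.commute)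
    then have "[:\<pi>:] dvd U * V" by (rule dvdI)
    then consider "[:\<pi>:] dvd U" | "[:\<pi>:] dvd V" using pr by (meson prime_elem_dvd_multD)
    then show ?thesis
    proof cases
      case 1
      then obtain U1 where U1: "U = smult \<pi> U1" by (auto elim!: dvdE)
      have "smult \<pi> (U1 * V) = smult \<pi> (smult c' W)" using less.prems(1) U1 c' by simp
      then have "U1 * V = smult c' W" using smult_cancel[OF c0(1)] by blast
      from less.hyps[OF lt this c0(2) less.prems(3)] obtain d U' where
        "U1 = smult d U'" "lead_coeff U' = 1" by blast
      then show ?thesis using U1 by (metis smult_smult)
    next
      case 2
      then obtain V1 where V1: "V = smult \<pi> V1" by (auto elim!: dvdE)
      have "smult \<pi> (U * V1) = smult \<pi> (smult c' W)" using less.prems(1) V1 c' by simp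
      then have "U * V1 = smult c' W" using smult_cancel[OF c0(1)] by blast
      from less.hyps[OF lt this c0(2) less.prems(3)] show ?thesis .
    qed
  qed
qed

section \<open>Polynomials in an outer variable \<open>T\<close> over \<open>K[t]\<close>; here
  \<open>lift_const b\<close> is b(T), and evaluation at \<open>[:0, 1:]\<close> sets T = t\<close>

definition lift_const :: "'k::field poly \<Rightarrow> 'k poly poly" where
  "lift_const b = map_poly (\<lambda>c. [:c:]) b"

lemma coeff_lift_const [simp]: "coeff (lift_const b) i = [:coeff b i:]"
  by (simp add: lift_const_def coeff_map_poly)

lemma degree_lift_const [simp]: "degree (lift_const b) = degree b"
  unfolding lift_const_def by (rule degree_map_poly) auto

lemma lift_const_pCons: "lift_const (pCons a b) = pCons [:a:] (lift_const b)"
  unfolding lift_const_def by (rule map_poly_pCons) auto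

lemma poly_lift_const: "poly (lift_const b) [:0, 1:] = b"
  by (induction b) (simp_all add: lift_const_pCons, simp add: lift_const_def)

text \<open>Bounds take the place of exact degrees because in \<open>slice_mult\<close> some
  coefficients may fall short of the maximal degree in t.\<close>

lemma coeff_mult_at_bound:
  fixes p q :: "'a::comm_semiring_0 poly"
  assumes "degree p \<le> m" "degree q \<le> n"
  shows "coeff (p * q) (m + n) = coeff p m * coeff q n"
proof -
  have "coeff p i * coeff q (m + n - i) = (if i = m then coeff p m * coeff q n else 0)"
    if "i \<le> m + n" for i
  proof (cases i m rule: linorder_cases)
    case less
    then have "n < m + n - i" by simp
    then have "coeff q (m + n - i) = 0" using assms(2) by (intro coeff_eq_0) simp
    then show ?thesis using less by simp
  next
    case greater
    then have "coeff p i = 0" using assms(1) by (intro coeff_eq_0) simp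
    then show ?thesis using greater by simp
  qed simp
  then have "coeff (p * q) (m + n) = (\<Sum>i\<le>m+n. if i = m then coeff p m * coeff q n else 0)"
    unfolding coeff_mult by (intro sum.cong) auto
  also have "\<dots> = coeff p m * coeff q n" by simp
  finally show ?thesis .
qed

text \<open>This is the coefficient of t^m once the roles of T and t are exchanged.\<close>

definition slice :: "nat \<Rightarrow> 'k::zero poly poly \<Rightarrow> 'k poly" where
  "slice m F = map_poly (\<lambda>c. coeff c m) F"

lemma coeff_slice [simp]: "coeff (slice m F) i = coeff (coeff F i) m"
  by (simp add: slice_def coeff_map_poly)

text \<open>Under these bounds the slices are the leading parts with respect to t, and leading parts
  multiply.\<close>

lemma slice_mult:
  fixes F G :: "'k::comm_semiring_0 poly poly"
  assumes "\<And>i. degree (coeff F i) \<le> m" "\<And>i. degree (coeff G i) \<le> n"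
  shows "slice (m + n) (F * G) = slice m F * slice n G"
  by (rule poly_eqI) (simp add: coeff_mult[of F G] coeff_mult[of "slice m F"] coeff_sum coeff_mult_at_bound assms)

lemma ex_max_coeff_degree:
  fixes F :: "'k::zero poly poly"
  obtains j where "\<And>i. degree (coeff F i) \<le> degree (coeff F j)"
proof -
  have fin: "finite (range (\<lambda>i. degree (coeff F i)))"
    by (rule finite_subset[of _ "insert 0 ((\<lambda>i. degree (coeff F i)) ` {..degree F})"])
       (auto simp: image_iff, metis atMost_iff degree_0 le_degree)
  define M where "M = Max (range (\<lambda>i. degree (coeff F i)))"
  have "M \<in> range (\<lambda>i. degree (coeff F i))" unfolding M_def using fin by (intro Max_in) auto
  then obtain j where "degree (coeff F j) = M" by auto
  moreover have "degree (coeff F i) \<le> M" for i unfolding M_def using fin by (intro Max_ge) auto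
  ultimately show ?thesis using that by metis
qed

section \<open>Subalgebras of \<open>K[t]\<close> and their fractional closure\<close>

locale poly_subalgebra =
  fixes B :: "'k::field poly set"
  assumes const_closed: "[:c:] \<in> B"
    and add_closed: "a \<in> B \<Longrightarrow> b \<in> B \<Longrightarrow> a + b \<in> B"
    and mult_closed: "a \<in> B \<Longrightarrow> b \<in> B \<Longrightarrow> a * b \<in> B"
begin

lemma zero_closed: "0 \<in> B"
  using const_closed[of 0] by simp

lemma one_closed: "1 \<in> B"
  using const_closed[of 1] by (simp add: one_pCons)

lemma smult_closed: "a \<in> B \<Longrightarrow> smult c a \<in> B"
  using mult_closed[OF const_closed[of c], of a] by simp

lemma diff_closed: "a \<in> B \<Longrightarrow> b \<in> B \<Longrightarrow> a - b \<in> B"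
  using add_closed[OF _ smult_closed[of b "-1"], of a] by simp

lemma power_closed: "a \<in> B \<Longrightarrow> a ^ n \<in> B"
  by (induction n) (auto intro: one_closed mult_closed)

lemma prod_closed: "(\<And>i. i \<in> I \<Longrightarrow> f i \<in> B) \<Longrightarrow> prod f I \<in> B"
  by (induction I rule: infinite_finite_induct) (auto intro: one_closed mult_closed)

text \<open>The intersection of \<open>K[t]\<close> with the field of fractions of \<open>B\<close>,
  expressed without constructing that field.\<close>

definition frac_closure :: "'k poly set" where
  "frac_closure = {c. \<exists>b\<in>B. b \<noteq> 0 \<and> b * c \<in> B}"

lemma poly_subalgebra_frac_closure: "poly_subalgebra frac_closure"
proof
  show "[:c:] \<in> frac_closure" for c
    unfolding frac_closure_def using one_closed const_closed by (auto intro!: bexI[of _ 1])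
next
  fix a b assume "a \<in> frac_closure" "b \<in> frac_closure"
  then obtain s t where st: "s \<in> B" "s \<noteq> 0" "s * a \<in> B" "t \<in> B" "t \<noteq> 0" "t * b \<in> B"
    unfolding frac_closure_def by blast
  have "(s * t) * (a + b) = t * (s * a) + s * (t * b)" by (simp add: algebra_simps)
  then have "(s * t) * (a + b) \<in> B" using st by (simp add: add_closed mult_closed)
  moreover have "(s * t) * (a * b) \<in> B" using mult_closed[OF st(3,6)] by (simp add: mult_ac)
  moreover have "s * t \<in> B" "s * t \<noteq> 0" using st by (auto intro: mult_closed)
  ultimately show "a + b \<in> frac_closure" "a * b \<in> frac_closure"
    unfolding frac_closure_def mem_Collect_eq by (meson bexI)+
qed

lemma subset_frac_closure: "B \<subseteq> frac_closure"
  unfolding frac_closure_def using one_closed by (auto intro!: bexI[of _ 1])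

text \<open>As a module over \<open>K[w]\<close>, the fractional closure is generated by elements of minimal
  degree in each residue class modulo \<open>degree w\<close>; the product of their denominators is a common
  denominator.\<close>

lemma common_denominator:
  assumes w: "w \<in> B" "degree w > 0"
  obtains d where "d \<in> B" "d \<noteq> 0" "\<And>c. c \<in> frac_closure \<Longrightarrow> d * c \<in> B"
proof -
  interpret C: poly_subalgebra frac_closure by (rule poly_subalgebra_frac_closure)
  define k where "k = degree w"
  define S where "S r = {c \<in> frac_closure. c \<noteq> 0 \<and> degree c mod k = r}" for r
  define e where "e r = (ARG_MIN degree c. c \<in> S r)" for r
  have e: "e r \<in> S r" "degree (e r) \<le> degree c" if "c \<in> S r" for r c
    unfolding e_def using arg_min_natI[of "\<lambda>c. c \<in> S r" c degree]
      arg_min_nat_le[of "\<lambda>c. c \<in> S r" c degree] that by auto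
  \<comment> \<open>Where the residue class is empty, \<open>e r\<close> is meaningless and the
    denominator 1 is chosen.\<close>
  have "\<exists>\<delta>\<in>B. \<delta> \<noteq> 0 \<and> (S r \<noteq> {} \<longrightarrow> \<delta> * e r \<in> B)" for r
  proof (cases "S r = {}")
    case False
    then have "e r \<in> frac_closure" using e(1)[of _ r] unfolding S_def by blast
    then show ?thesis unfolding frac_closure_def by blast
  qed (use one_closed in \<open>auto intro!: bexI[of _ 1]\<close>)
  then obtain \<delta> where \<delta>: "\<delta> r \<in> B" "\<delta> r \<noteq> 0" "S r \<noteq> {} \<Longrightarrow> \<delta> r * e r \<in> B" for r by metis
  define d where "d = (\<Prod>r<k. \<delta> r)"
  have de: "d * e r \<in> B" if "r < k" "S r \<noteq> {}" for r
  proof -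
    have "d = \<delta> r * (\<Prod>i\<in>{..<k} - {r}. \<delta> i)"
      unfolding d_def using that(1) by (subst prod.remove[of _ r]) auto
    then have "d * e r = (\<delta> r * e r) * (\<Prod>i\<in>{..<k} - {r}. \<delta> i)" by (simp add: mult_ac)
    also have "\<dots> \<in> B" using \<delta> that(2) by (intro mult_closed[OF \<delta>(3)] prod_closed) auto
    finally show ?thesis .
  qed
  have "d * c \<in> B" if "c \<in> frac_closure" for c
    using that
  proof (induction "degree c" arbitrary: c rule: less_induct)
    case less
    show ?case
    proof (cases "c = 0")
      case True
      then show ?thesis by (simp add: zero_closed)
    next
      case False
      define r where "r = degree c mod k"
      have cS: "c \<in> S r" using less.prems False by (simp add: S_def r_def)
      note er = e[OF cS]
      have r: "r < k" using w(2) by (simp add: r_def k_def)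
      have "degree (e r) mod k = degree c mod k" using er(1) by (simp add: S_def r_def)
      then obtain j where j: "degree c = degree (e r) + k * j"
        using er(2) by (metis mod_eq_dvd_iff_nat dvdE le_add_diff_inverse)
      \<comment> \<open>The degrees of \<open>c\<close> and \<open>e r\<close> agree modulo
        \<open>k\<close>, so a power of \<open>w\<close> fills the gap; cancelling the leading term
        of \<open>c\<close> against \<open>u\<close> makes the induction on the degree work.\<close>
      define u where "u = w ^ j * e r"
      have e0: "e r \<noteq> 0" "w \<noteq> 0" using er(1) w by (auto simp: S_def)
      then have u0: "u \<noteq> 0" and degu: "degree u = degree c"
        using j by (auto simp: u_def degree_mult_eq degree_power_eq k_def)
      define g where "g = lead_coeff c / lead_coeff u"
      have g0: "g \<noteq> 0" using False u0 by (simp add: g_def)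
      define c' where "c' = c - smult g u"
      have uC: "u \<in> frac_closure" using er(1) w subset_frac_closure
        by (auto simp: u_def S_def intro: C.mult_closed C.power_closed)
      have c'C: "c' \<in> frac_closure"
        unfolding c'_def by (intro C.diff_closed C.smult_closed less.prems uC)
      have "c' = 0 \<or> degree c' < degree c"
        unfolding c'_def by (rule degree_diff_less_cancel) (use g0 degu u0 in \<open>auto simp: g_def\<close>)
      then have "d * c' \<in> B" using less.hyps[OF _ c'C] by (auto intro: zero_closed)
      moreover have "d * u \<in> B"
      proof -
        have eq: "d * u = w ^ j * (d * e r)" by (simp add: u_def mult_ac)
        have "d * e r \<in> B" using de[OF r] cS by blast
        then show ?thesis unfolding eq by (rule mult_closed[OF power_closed[OF w(1)]])
      qed
      moreover have "d * c = d * c' + smult g (d * u)" 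
        unfolding c'_def by (simp add: right_diff_distrib)
      ultimately show ?thesis by (simp add: add_closed smult_closed)
    qed
  qed
  moreover have "d \<in> B" unfolding d_def by (rule prod_closed) (rule \<delta>(1))
  moreover have "d \<noteq> 0" using \<delta>(2) by (simp add: d_def)
  ultimately show ?thesis by (rule that[rotated 2])
qed

section \<open>Annihilating polynomials of t over \<open>B\<close>, and the polynomial theorem of
  Lueroth\<close>

definition annihilators :: "'k poly poly set" where
  "annihilators = {F. (\<forall>i. coeff F i \<in> B) \<and> poly F [:0, 1:] = 0}"

lemma annihilators_lift_const: "b \<in> B \<Longrightarrow> lift_const b - [:b:] \<in> annihilators"
  by (auto simp: annihilators_def poly_lift_const const_closed coeff_pCons diff_closed zero_closed
      split: nat.split)

lemma annihilators_diff: "F \<in> annihilators \<Longrightarrow> G \<in> annihilators \<Longrightarrow> F - G \<in> annihilators"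
  by (auto simp: annihilators_def diff_closed)

lemma annihilators_smult: "F \<in> annihilators \<Longrightarrow> c \<in> B \<Longrightarrow> smult c F \<in> annihilators"
  by (auto simp: annihilators_def mult_closed)

lemma annihilators_shift: "F \<in> annihilators \<Longrightarrow> monom 1 k * F \<in> annihilators"
  by (auto simp: annihilators_def coeff_monom_mult zero_closed)

text \<open>Pseudo-division by \<open>G\<close>: multiplying by its leading coefficient in place of
  dividing keeps all coefficients in \<open>B\<close>, and minimality leaves no nonzero
  remainder.\<close>

lemma minimal_annihilator_dvd:
  assumes G: "G \<in> annihilators" "G \<noteq> 0"
    and min: "\<And>F. F \<in> annihilators \<Longrightarrow> F \<noteq> 0 \<Longrightarrow> degree G \<le> degree F"
    and F: "F \<in> annihilators"
  shows "\<exists>n. G dvd smult (lead_coeff G ^ n) F"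
  using F
proof (induction "degree F" arbitrary: F rule: less_induct)
  case less
  show ?case
  proof (cases "F = 0")
    case False
    define k where "k = degree F - degree G"
    have k: "degree F = k + degree G" using min[OF less.prems False] by (simp add: k_def)
    define P where "P = smult (lead_coeff G) F"
    define Q where "Q = smult (lead_coeff F) (monom 1 k * G)"
    have B: "lead_coeff F \<in> B" "lead_coeff G \<in> B"
      using less.prems G(1) by (auto simp: annihilators_def)
    have dQ: "degree (monom 1 k * G) = degree F" "lead_coeff (monom 1 k * G) = lead_coeff G"
      using G(2) k by (auto simp: degree_mult_eq degree_monom_eq coeff_monom_mult)
    have "P - Q = 0 \<or> degree (P - Q) < degree P"
      by (rule degree_diff_less_cancel) (use G(2) False dQ in \<open>auto simp: P_def Q_def\<close>)
    then have "P - Q = 0 \<or> degree (P - Q) < degree F" using G(2) by (simp add: P_def)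
    moreover have "P - Q \<in> annihilators" unfolding P_def Q_def
      by (intro annihilators_diff annihilators_smult annihilators_shift less.prems G(1) B)
    ultimately obtain n where "G dvd smult (lead_coeff G ^ n) (P - Q)"
      using less.hyps[of "P - Q"] by (metis dvd_0_right smult_0_right)
    moreover have "G dvd smult (lead_coeff G ^ n) Q"
      unfolding Q_def by (intro dvd_smult dvd_mult) simp
    ultimately have "G dvd smult (lead_coeff G ^ n) (P - Q) + smult (lead_coeff G ^ n) Q"
      by (rule dvd_add)
    also have "\<dots> = smult (lead_coeff G ^ Suc n) F"
      by (simp add: P_def smult_diff_right mult.commute)
    finally show ?thesis by blast
  qed simp
qed

text \<open>Expand \<open>u\<close> in base \<open>h\<close> with digits of degree below
  \<open>degree h\<close>, then sort by powers of t; the coefficients become elements of K[h], the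
  range of \<open>\<lambda>q. pcompose q h\<close>.\<close>

lemma poly_expansion:
  assumes h: "h \<in> B" "degree h > 0"
  shows "\<exists>R. (\<forall>i. coeff R i \<in> range (\<lambda>q. pcompose q h)) \<and> degree R < degree h \<and> poly R [:0,1:] = u"
proof (induction "degree u" arbitrary: u rule: less_induct)
  case less
  have h0: "h \<noteq> 0" using h by auto
  show ?case
  proof (cases "degree u < degree h")
    case True
    have "coeff (lift_const u) i \<in> range (\<lambda>q. pcompose q h)" for i
      by (rule range_eqI[of _ _ "[:coeff u i:]"]) (simp add: pcompose_const)
    then show ?thesis using True by (intro exI[of _ "lift_const u"]) (simp add: poly_lift_const)
  next
    case False
    have u0: "u \<noteq> 0" using False h by auto
    have "degree (u div h) < degree u"
      using False h by (simp add: degree_div_less u0 h0)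
    from less.hyps[OF this] obtain R where R: "\<forall>i. coeff R i \<in> range (\<lambda>q. pcompose q h)"
      "degree R < degree h" "poly R [:0,1:] = u div h" by blast
    define S where "S = lift_const (u mod h) + smult h R"
    have "coeff S i \<in> range (\<lambda>q. pcompose q h)" for i
    proof -
      obtain q where q: "coeff R i = pcompose q h" using R(1) by auto
      have "coeff S i = pcompose ([:coeff (u mod h) i:] + pCons 0 q) h"
        by (simp add: S_def q pcompose_add pcompose_const pcompose_pCons)
      then show ?thesis by blast
    qed
    moreover have "degree S < degree h"
      unfolding S_def using R(2) degree_mod_less[OF h0, of u] h(2) h0
      by (intro degree_add_less) (auto intro: le_less_trans[OF degree_smult_le])
    moreover have "poly S [:0,1:] = u"
      by (simp add: S_def poly_lift_const R(3))
    ultimately show ?thesis by (intro exI[of _ S] conjI allI)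
  qed
qed

text \<open>Once the minimal polynomial \<phi> is known to have degree \<open>degree h\<close>, a
  base-\<open>h\<close> expansion of \<open>b\<close> in \<open>B\<close> would give a smaller
  annihilator of t unless it is just an element of K[h].\<close>

theorem generated_by_one:
  assumes w: "w \<in> B" "degree w > 0" and normal: "frac_closure \<subseteq> B"
  obtains h where "h \<in> B" "\<And>b. b \<in> B \<Longrightarrow> \<exists>q. b = pcompose q h"
proof -
  have "lift_const w - [:w:] \<in> annihilators \<and> lift_const w - [:w:] \<noteq> 0"
  proof -
    have "coeff (lift_const w - [:w:]) (degree w) = [:lead_coeff w:]" using w(2)
      by (simp add: coeff_pCons split: nat.split)
    then have "coeff (lift_const w - [:w:]) (degree w) \<noteq> 0" using w(2) by auto
    then show ?thesis using annihilators_lift_const[OF w(1)] by fastforce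
  qed
  then obtain G where G: "G \<in> annihilators" "G \<noteq> 0"
    and min: "\<And>F. F \<in> annihilators \<Longrightarrow> F \<noteq> 0 \<Longrightarrow> degree G \<le> degree F"
    using ex_has_least_nat[of "\<lambda>F. F \<in> annihilators \<and> F \<noteq> 0" _ degree] by blast
  \<comment> \<open>Scaling w(T) - w(t) to be monic in T prepares it for
    \<open>gauss_proportional_monic\<close>.\<close>
  define W where "W = smult [:inverse (lead_coeff w):] (lift_const w - [:w:])"
  have degW: "degree (lift_const w - [:w:]) = degree w"
    using w(2) by (metis degree_add_eq_left degree_lift_const degree_minus degree_pCons_0 diff_conv_add_uminus)
  have "lead_coeff w \<noteq> 0" using w(2) by auto
  then have "lead_coeff W = 1"
    using w(2) degW by (cases "degree w") (auto simp: W_def coeff_pCons one_pCons)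
  have Wan: "W \<in> annihilators" unfolding W_def
    by (intro annihilators_smult annihilators_lift_const w const_closed)
  obtain n where "G dvd smult (lead_coeff G ^ n) W"
    using minimal_annihilator_dvd[OF G min Wan] by blast
  then obtain V where "G * V = smult (lead_coeff G ^ n) W" by (metis dvdE)
  from gauss_proportional_monic[OF this _ \<open>lead_coeff W = 1\<close>] G(2)
  obtain g \<phi> where \<phi>: "G = smult g \<phi>" "lead_coeff \<phi> = 1" by auto
  have g: "lead_coeff G = g" using \<phi> by simp
  then have g0: "g \<noteq> 0" using G(2) by auto
  have gB: "g \<in> B" using G(1) g by (auto simp: annihilators_def)
  \<comment> \<open>These coefficients are fractions of \<open>B\<close> with denominator
    \<open>g\<close> and are polynomials in t, so \<open>normal\<close> applies.\<close>
  have \<phi>B: "coeff \<phi> i \<in> B" for i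
  proof -
    have "g * coeff \<phi> i \<in> B" using G(1) \<phi>(1) by (auto simp: annihilators_def)
    then show ?thesis using normal g0 gB by (auto simp: frac_closure_def)
  qed
  have \<phi>an: "\<phi> \<in> annihilators"
    using G(1) \<phi>(1) g0 \<phi>B by (auto simp: annihilators_def)
  have min\<phi>: "degree \<phi> \<le> degree F" if "F \<in> annihilators" "F \<noteq> 0" for F
    using min[OF that] \<phi>(1) g0 by simp
  have \<phi>0: "\<phi> \<noteq> 0" using \<phi>(2) by auto
  obtain j where j: "\<And>i. degree (coeff \<phi> i) \<le> degree (coeff \<phi> j)" by (rule ex_max_coeff_degree) blast
  define h where "h = coeff \<phi> j"
  have hB: "h \<in> B" by (simp add: h_def \<phi>B)
  \<comment> \<open>Otherwise all coefficients of \<phi> are constants, and t would be a root of a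
    nonzero polynomial over K.\<close>
  have m: "degree h > 0"
  proof (rule ccontr)
    assume "\<not> degree h > 0"
    then have "degree (coeff \<phi> i) = 0" for i using j[of i] by (simp add: h_def)
    then have "coeff \<phi> i = [:coeff (coeff \<phi> i) 0:]" for i by (metis degree_0_id)
    then have "\<phi> = lift_const (slice 0 \<phi>)" by (intro poly_eqI) simp
    moreover have "poly \<phi> [:0,1:] = 0" using \<phi>an by (simp add: annihilators_def)
    ultimately have "slice 0 \<phi> = 0" by (metis poly_lift_const)
    then show False using \<open>\<phi> = _\<close> \<phi>0 by (metis lift_const_def map_poly_0)
  qed
  have "\<exists>n. \<phi> dvd smult (lead_coeff \<phi> ^ n) (lift_const h - [:h:])"
    by (rule minimal_annihilator_dvd[OF \<phi>an \<phi>0 min\<phi> annihilators_lift_const[OF hB]])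
  then have "\<phi> dvd lift_const h - [:h:]" using \<phi>(2) by simp
  then obtain q where q: "lift_const h - [:h:] = \<phi> * q" by (elim dvdE)
  \<comment> \<open>Both h(T) - h(t) and \<phi> have degree \<open>degree h\<close> in t, so
    \<open>q\<close> is free of t. The coefficient of t^(degree h) on the left is a nonzero
    constant, so \<open>q\<close> is free of T too.\<close>
  obtain l where l: "\<And>i. degree (coeff q i) \<le> degree (coeff q l)" by (rule ex_max_coeff_degree) blast
  have sl: "slice (degree h + degree (coeff q l)) (lift_const h - [:h:])
      = slice (degree h) \<phi> * slice (degree (coeff q l)) q"
    unfolding q by (rule slice_mult) (use j l in \<open>auto simp: h_def\<close>)
  have degh: "degree (lift_const h - [:h:]) = degree h"
    using m by (metis degree_add_eq_left degree_lift_const degree_minus degree_pCons_0 diff_conv_add_uminus)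
  have q0: "q \<noteq> 0" using q degh m by auto
  have s1: "slice (degree h) \<phi> \<noteq> 0"
  proof
    assume "slice (degree h) \<phi> = 0"
    then have "coeff (slice (degree h) \<phi>) j = 0" by simp
    then show False using m by (auto simp: h_def)
  qed
  \<comment> \<open>As 0 has degree 0, the choice of \<open>l\<close> does not exclude
    \<open>coeff q l = 0\<close>; in that case every coefficient is constant and the slice is all of
    \<open>q\<close>.\<close>
  have s2: "slice (degree (coeff q l)) q \<noteq> 0"
  proof
    assume s: "slice (degree (coeff q l)) q = 0"
    then have "coeff (slice (degree (coeff q l)) q) l = 0" by simp
    then have "coeff q l = 0" by simp
    then have l0: "degree (coeff q i) = 0" for i using l[of i] by simp
    have "coeff q i = 0" for i
    proof -
      have "coeff (slice (degree (coeff q l)) q) i = 0" using s by simp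
      then show ?thesis using l0 by (metis coeff_slice leading_coeff_0_iff)
    qed
    then show False using q0 by (metis leading_coeff_0_iff)
  qed
  have ql: "degree (coeff q l) = 0"
  proof (rule ccontr)
    assume *: "degree (coeff q l) \<noteq> 0"
    have "slice (degree h + degree (coeff q l)) (lift_const h - [:h:]) = 0"
      using * m by (intro poly_eqI) (auto simp: coeff_pCons coeff_eq_0 split: nat.split)
    then show False using sl s1 s2 by auto
  qed
  have "degree (slice (degree h) \<phi> * slice 0 q) = 0"
  proof -
    have "slice (degree h) (lift_const h - [:h:]) = [:- lead_coeff h:]"
      using m by (intro poly_eqI) (auto simp: coeff_pCons split: nat.split)
    then show ?thesis using sl ql by (metis add.right_neutral degree_pCons_0)
  qed
  then have "degree (slice 0 q) = 0" using s1 s2 ql by (simp add: degree_mult_eq)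
  moreover have "degree (slice 0 q) = degree q"
  proof -
    have "degree (coeff q i) = 0" for i using l[of i] ql by simp
    then have "coeff q i = [:coeff (coeff q i) 0:]" for i by (metis degree_0_id)
    then have "q = lift_const (slice 0 q)" by (intro poly_eqI) simp
    then show ?thesis by (metis degree_lift_const)
  qed
  ultimately have n: "degree \<phi> = degree h"
    using degh q \<phi>0 q0 by (simp add: degree_mult_eq)
  have "\<exists>q. b = pcompose q h" if b: "b \<in> B" for b
  proof -
    obtain R where R: "\<forall>i. coeff R i \<in> range (\<lambda>q. pcompose q h)"
      "degree R < degree h" "poly R [:0,1:] = b" using poly_expansion[OF hB m] by blast
    have inB: "pcompose q h \<in> B" for q
      by (induction q) (auto simp: pcompose_pCons intro: zero_closed add_closed const_closed mult_closed hB)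
    \<comment> \<open>Subtracting \<open>b\<close> changes only the constant term in T, so the
      degree stays below that of \<phi> and the difference must vanish.\<close>
    have "R - [:b:] \<in> annihilators"
    proof -
      have "coeff R i \<in> B" for i using R(1) inB by (metis imageE)
      then show ?thesis using R(3) b
        by (auto simp: annihilators_def coeff_pCons intro: diff_closed zero_closed split: nat.split)
    qed
    moreover have "degree (R - [:b:]) < degree \<phi>"
      using R(2) m n by (intro degree_diff_less) auto
    ultimately have "R - [:b:] = 0" using min\<phi> by (metis leD)
    then have "coeff R 0 = b" by simp
    then show ?thesis using R(1) by (metis imageE)
  qed
  then show ?thesis using that hB by blast
qed

end

section \<open>Multivariate polynomials\<close>

lemma sum_monomials: "(\<Sum>t\<in>Poly_Mapping.keys F. Poly_Mapping.single t (Poly_Mapping.lookup F t)) = F"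
  by (rule poly_mapping_eqI) (simp add: lookup_sum lookup_single when_def not_in_keys_iff_lookup_eq_zero)

lemma mult_sum_monomials:
  "F * G = (\<Sum>s\<in>Poly_Mapping.keys F. \<Sum>t\<in>Poly_Mapping.keys G.
     Poly_Mapping.single (s + t) (Poly_Mapping.lookup F s * Poly_Mapping.lookup G t))"
proof -
  have "F * G = (\<Sum>s\<in>Poly_Mapping.keys F. Poly_Mapping.single s (Poly_Mapping.lookup F s)) *
      (\<Sum>t\<in>Poly_Mapping.keys G. Poly_Mapping.single t (Poly_Mapping.lookup G t))"
    by (simp only: sum_monomials)
  then show ?thesis by (simp add: sum_product mult_single)
qed

text \<open>A ring map on coefficients and a multiplicative map on monomials extend to a ring
  homomorphism \<open>ext\<close>; one target will be \<open>K[t]\<close>, the other the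
  multivariate ring itself.\<close>

locale monomial_hom =
  fixes \<kappa> :: "'k::comm_ring_1 \<Rightarrow> 'r::comm_ring_1" and T :: "('v \<Rightarrow>\<^sub>0 nat) \<Rightarrow> 'r"
  assumes \<kappa>_add: "\<kappa> (a + b) = \<kappa> a + \<kappa> b" and \<kappa>_mult: "\<kappa> (a * b) = \<kappa> a * \<kappa> b" and \<kappa>_1: "\<kappa> 1 = 1"
    and T_add: "T (s + t) = T s * T t" and T_0: "T 0 = 1"
begin

definition ext :: "('v, 'k) mpoly \<Rightarrow> 'r" where
  "ext F = (\<Sum>t\<in>Poly_Mapping.keys F. \<kappa> (Poly_Mapping.lookup F t) * T t)"

lemma \<kappa>_0 [simp]: "\<kappa> 0 = 0"
  using \<kappa>_add[of 0 0] by simp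

lemma ext_superset:
  assumes "finite K" "Poly_Mapping.keys F \<subseteq> K"
  shows "ext F = (\<Sum>t\<in>K. \<kappa> (Poly_Mapping.lookup F t) * T t)"
  unfolding ext_def using assms by (intro sum.mono_neutral_left) (auto simp: in_keys_iff)

lemma ext_0 [simp]: "ext 0 = 0"
  by (simp add: ext_def)

lemma ext_add: "ext (F + G) = ext F + ext G"
proof -
  let ?K = "Poly_Mapping.keys F \<union> Poly_Mapping.keys G"
  show ?thesis
    using ext_superset[of ?K F] ext_superset[of ?K G] ext_superset[of ?K "F + G"] keys_add[of F G]
    by (simp add: lookup_add \<kappa>_add distrib_right sum.distrib)
qed

lemma ext_single: "ext (Poly_Mapping.single t c) = \<kappa> c * T t"
  using ext_superset[of "{t}" "Poly_Mapping.single t c"] by simp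

lemma ext_sum: "ext (sum f I) = (\<Sum>i\<in>I. ext (f i))"
  by (induction I rule: infinite_finite_induct) (simp_all add: ext_add)

lemma ext_mult: "ext (F * G) = ext F * ext G"
proof -
  have "ext (F * G) = (\<Sum>s\<in>Poly_Mapping.keys F. \<Sum>t\<in>Poly_Mapping.keys G.
      (\<kappa> (Poly_Mapping.lookup F s) * T s) * (\<kappa> (Poly_Mapping.lookup G t) * T t))"
    by (subst mult_sum_monomials) (simp add: ext_sum ext_single \<kappa>_mult T_add mult_ac)
  then show ?thesis by (simp add: ext_def sum_product)
qed

lemma ext_diff: "ext (F - G) = ext F - ext G"
  using ext_add[of "F - G" G] by (simp add: algebra_simps)

lemma ext_const: "ext (const c) = \<kappa> c"
  by (simp add: const_def ext_single T_0)

lemma ext_dvd: "F dvd G \<Longrightarrow> ext F dvd ext G"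
  by (auto simp: dvd_def ext_mult)

end

lemma eval_at_0 [simp]: "eval_at 0 f = 0"
  by (simp add: eval_at_def)

lemma const_0 [simp]: "const 0 = 0"
  by (simp add: const_def)

lemma eval_at_pCons: "eval_at (pCons a h) f = const a + f * eval_at h f"
  by (simp add: eval_at_def map_poly_pCons)

lemma const_add: "const (a + b) = const a + const b"
  by (simp add: const_def single_add)

lemma const_mult: "const (a * b :: 'k::comm_ring_1) = const a * const b"
  by (simp add: const_def mult_single)

lemma const_1: "const 1 = 1"
  by (simp add: const_def)

lemma eval_at_add: "eval_at (g + h) f = eval_at g f + eval_at h f"
proof (induction g arbitrary: h)
  case (pCons a g)
  then show ?case
    by (cases h) (simp add: eval_at_pCons const_add algebra_simps)
qed simp

lemma eval_at_smult: "eval_at (smult c h) f = const c * eval_at h f"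
  by (induction h) (simp_all add: eval_at_pCons const_mult algebra_simps)

lemma eval_at_monom: "eval_at (monom c n) f = const c * f ^ n"
  by (induction n) (simp_all add: monom_0 monom_Suc eval_at_pCons mult_ac)

lemma eval_at_sum: "eval_at (sum h I) f = (\<Sum>i\<in>I. eval_at (h i) f)"
  by (induction I rule: infinite_finite_induct) (simp_all add: eval_at_add)

section \<open>Polynomials in a prescribed set of variables\<close>

definition polys_in :: "'v set \<Rightarrow> ('v, 'k::zero) mpoly set" where
  "polys_in S = {f. vars f \<subseteq> S}"

lemma polys_in_iff: "f \<in> polys_in S \<longleftrightarrow> (\<forall>t\<in>Poly_Mapping.keys f. Poly_Mapping.keys t \<subseteq> S)"
  by (auto simp: polys_in_def vars_def)

lemma polys_in_0 [simp]: "0 \<in> polys_in S"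
  by (simp add: polys_in_iff)

lemma polys_in_const: "const c \<in> polys_in S"
  by (auto simp: polys_in_iff const_def)

lemma polys_in_add: "f \<in> polys_in S \<Longrightarrow> g \<in> polys_in S \<Longrightarrow> f + g \<in> polys_in S"
  unfolding polys_in_iff using keys_add[of f g] by (metis Un_iff subsetD)

lemma polys_in_mult: "f \<in> polys_in S \<Longrightarrow> g \<in> polys_in S \<Longrightarrow> f * g \<in> polys_in S"
proof -
  assume fg: "f \<in> polys_in S" "g \<in> polys_in S"
  show ?thesis
    unfolding polys_in_iff
  proof
    fix u assume "u \<in> Poly_Mapping.keys (f * g)"
    then obtain s t where u: "u = s + t" and "s \<in> Poly_Mapping.keys f" "t \<in> Poly_Mapping.keys g"
      using keys_mult[of f g] by blast
    then have "Poly_Mapping.keys s \<subseteq> S" "Poly_Mapping.keys t \<subseteq> S"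
      using fg by (auto simp: polys_in_iff)
    then show "Poly_Mapping.keys u \<subseteq> S" using keys_add[of s t] unfolding u by blast
  qed
qed

lemma polys_in_disjoint:
  assumes "f \<in> polys_in S" "f \<in> polys_in (- S)"
  shows "f = const (Poly_Mapping.lookup f 0)"
proof (rule poly_mapping_eqI)
  fix t
  have "t = 0" if "t \<in> Poly_Mapping.keys f"
  proof -
    have "Poly_Mapping.keys t = {}" using assms that unfolding polys_in_iff by blast
    then show ?thesis by simp
  qed
  then show "Poly_Mapping.lookup f t = Poly_Mapping.lookup (const (Poly_Mapping.lookup f 0)) t"
    by (auto simp: const_def lookup_single when_def in_keys_iff)
qed

section \<open>Monomial orders, leading monomials and division\<close>

locale monomial_order =
  fixes ord :: "('v \<Rightarrow>\<^sub>0 nat) \<Rightarrow> 'o::wellorder"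
  assumes inj_ord: "inj ord"
    and ord_add: "ord s < ord t \<Longrightarrow> ord (s + u) < ord (t + u)"
begin

text \<open>The leading monomial; its value at 0 is arbitrary.\<close>

definition lm :: "('v, 'k::zero) mpoly \<Rightarrow> ('v \<Rightarrow>\<^sub>0 nat)" where
  "lm F = inv_into (Poly_Mapping.keys F) ord (Max (ord ` Poly_Mapping.keys F))"

lemma
  assumes "F \<noteq> 0"
  shows lm_in_keys: "lm F \<in> Poly_Mapping.keys F"
    and ord_lm: "ord (lm F) = Max (ord ` Poly_Mapping.keys F)"
proof -
  have "Max (ord ` Poly_Mapping.keys F) \<in> ord ` Poly_Mapping.keys F"
    using assms by (intro Max_in) auto
  then show "lm F \<in> Poly_Mapping.keys F" "ord (lm F) = Max (ord ` Poly_Mapping.keys F)"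
    unfolding lm_def by (rule inv_into_into, rule f_inv_into_f)
qed

lemma ord_le_lm: "t \<in> Poly_Mapping.keys F \<Longrightarrow> ord t \<le> ord (lm F)"
  by (subst ord_lm) auto

lemma lm_eqI:
  assumes "t \<in> Poly_Mapping.keys F" "\<And>s. s \<in> Poly_Mapping.keys F \<Longrightarrow> ord s \<le> ord t"
  shows "lm F = t"
proof -
  have "F \<noteq> 0" using assms(1) by auto
  then have "ord (lm F) \<le> ord t" "ord t \<le> ord (lm F)"
    using assms ord_le_lm lm_in_keys by auto
  then show ?thesis using inj_ord by (auto dest: injD)
qed

lemma ord_add_le: "ord s \<le> ord s' \<Longrightarrow> ord t \<le> ord t' \<Longrightarrow> ord (s + t) \<le> ord (s' + t')"
proof -
  assume "ord s \<le> ord s'" "ord t \<le> ord t'"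
  then have "ord s < ord s' \<or> s = s'" "ord t < ord t' \<or> t = t'"
    using inj_ord by (auto simp: le_less dest: injD)
  then have "ord (s + t) \<le> ord (s' + t)" "ord (s' + t) \<le> ord (s' + t')"
    using ord_add[of s s' t] ord_add[of t t' s'] by (auto simp: add.commute)
  then show ?thesis by (rule order.trans)
qed

lemma ord_add_eqD:
  assumes "ord s \<le> ord s'" "ord t \<le> ord t'" "s + t = s' + t'"
  shows "s = s' \<and> t = t'"
proof -
  have "\<not> ord s < ord s'"
  proof
    assume "ord s < ord s'"
    then have "ord (s + t) < ord (s' + t)" by (rule ord_add)
    also have "\<dots> \<le> ord (s' + t')" using assms by (intro ord_add_le) auto
    finally show False using assms by simp
  qed
  then have "s = s'" using assms inj_ord by (auto dest: injD)
  then show ?thesis using assms(3) by simp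
qed

text \<open>By \<open>ord_add_eqD\<close>, only the pair of leading monomials contributes to the
  coefficient at their sum. This also rules out zero divisors.\<close>

lemma
  fixes F G :: "('v, 'k::idom) mpoly"
  assumes "F \<noteq> 0" "G \<noteq> 0"
  shows mult_nonzero: "F * G \<noteq> 0"
    and lm_mult: "lm (F * G) = lm F + lm G"
    and lookup_lm_mult: "Poly_Mapping.lookup (F * G) (lm F + lm G) =
      Poly_Mapping.lookup F (lm F) * Poly_Mapping.lookup G (lm G)"
proof -
  let ?l = Poly_Mapping.lookup
  have "?l (F * G) (lm F + lm G) = (\<Sum>s\<in>Poly_Mapping.keys F. \<Sum>t\<in>Poly_Mapping.keys G.
      (?l F s * ?l G t when s + t = lm F + lm G))"
    by (subst mult_sum_monomials) (simp add: lookup_sum lookup_single)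
  also have "\<dots> = (\<Sum>s\<in>Poly_Mapping.keys F. \<Sum>t\<in>Poly_Mapping.keys G.
      if s = lm F then if t = lm G then ?l F s * ?l G t else 0 else 0)"
  proof (intro sum.cong refl)
    fix s t assume "s \<in> Poly_Mapping.keys F" "t \<in> Poly_Mapping.keys G"
    then have "s + t = lm F + lm G \<longleftrightarrow> s = lm F \<and> t = lm G"
      using ord_add_eqD[OF ord_le_lm ord_le_lm] by blast
    then show "(?l F s * ?l G t when s + t = lm F + lm G) =
      (if s = lm F then if t = lm G then ?l F s * ?l G t else 0 else 0)"
      by (simp add: when_def)
  qed
  also have "\<dots> = (\<Sum>s\<in>Poly_Mapping.keys F. if s = lm F then ?l F s * ?l G (lm G) else 0)"
    by (intro sum.cong refl) (use lm_in_keys[OF assms(2)] in auto)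
  also have "\<dots> = ?l F (lm F) * ?l G (lm G)"
    using lm_in_keys[OF assms(1)] by auto
  finally show eq: "?l (F * G) (lm F + lm G) = ?l F (lm F) * ?l G (lm G)" .
  moreover have "?l F (lm F) \<noteq> 0" "?l G (lm G) \<noteq> 0"
    using assms lm_in_keys by (auto simp flip: in_keys_iff)
  ultimately have nz: "lm F + lm G \<in> Poly_Mapping.keys (F * G)"
    by (simp add: in_keys_iff)
  then show "F * G \<noteq> 0" by auto
  show "lm (F * G) = lm F + lm G"
  proof (rule lm_eqI[OF nz])
    fix u assume "u \<in> Poly_Mapping.keys (F * G)"
    then obtain s t where "u = s + t" "s \<in> Poly_Mapping.keys F" "t \<in> Poly_Mapping.keys G"
      using keys_mult[of F G] by blast
    then show "ord u \<le> ord (lm F + lm G)" by (auto intro: ord_add_le ord_le_lm)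
  qed
qed

lemma power_nonzero: "F \<noteq> 0 \<Longrightarrow> F ^ n \<noteq> 0" for F :: "('v, 'k::idom) mpoly"
  by (induction n) (auto simp: mult_nonzero)

lemma lookup_lm_power:
  fixes F :: "('v, 'k::idom) mpoly"
  assumes "F \<noteq> 0"
  shows "Poly_Mapping.lookup (lm (F ^ n)) v = n * Poly_Mapping.lookup (lm F) v"
proof (induction n)
  case 0
  have "lm (1 :: ('v, 'k) mpoly) = 0" by (rule lm_eqI) auto
  then show ?case by simp
next
  case (Suc n)
  then show ?case using assms by (simp add: lm_mult power_nonzero lookup_add)
qed

lemma mult_cancel: "F \<noteq> 0 \<Longrightarrow> F * G = F * H \<Longrightarrow> G = H" for F :: "('v, 'k::idom) mpoly"
  using mult_nonzero[of F "G - H"] by (auto simp: right_diff_distrib)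

text \<open>Leading terms are cancelled as long as \<open>lm b\<close> divides them, and the
  well-order stops the process. Only the leading monomial of the remainder is controlled, which is
  all that the later arguments use.\<close>

lemma division:
  fixes a b :: "('v, 'k::field) mpoly"
  assumes "b \<noteq> 0"
  obtains q where "a - q * b = 0 \<or>
    \<not> (\<forall>v. Poly_Mapping.lookup (lm b) v \<le> Poly_Mapping.lookup (lm (a - q * b)) v)"
proof -
  have "\<exists>q. a - q * b = 0 \<or>
    \<not> (\<forall>v. Poly_Mapping.lookup (lm b) v \<le> Poly_Mapping.lookup (lm (a - q * b)) v)"
  proof (induction "ord (lm a)" arbitrary: a rule: less_induct)
    case less
    show ?case
    proof (cases "a \<noteq> 0 \<and> (\<forall>v. Poly_Mapping.lookup (lm b) v \<le> Poly_Mapping.lookup (lm a) v)")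
      case False
      then show ?thesis by (intro exI[of _ 0]) auto
    next
      case True
      define c where "c = Poly_Mapping.lookup a (lm a) / Poly_Mapping.lookup b (lm b)"
      define m where "m = Poly_Mapping.single (lm a - lm b) c"
      have nz: "Poly_Mapping.lookup a (lm a) \<noteq> 0" "Poly_Mapping.lookup b (lm b) \<noteq> 0"
        using lm_in_keys True assms by (auto simp flip: in_keys_iff)
      then have c0: "c \<noteq> 0" by (simp add: c_def)
      then have km: "Poly_Mapping.keys m = {lm a - lm b}" by (simp add: m_def)
      then have m0: "m \<noteq> 0" by auto
      have lmm: "lm m = lm a - lm b" by (rule lm_eqI) (auto simp: km)
      have lkm: "Poly_Mapping.lookup m (lm m) = c" unfolding lmm by (simp add: m_def)
      have "lm m + lm b = lm a"
        unfolding lmm by (rule poly_mapping_eqI) (use True in \<open>simp add: lookup_add lookup_minus\<close>)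
      then have lmmb: "lm (m * b) = lm a" and lkmb:
        "Poly_Mapping.lookup (m * b) (lm a) = c * Poly_Mapping.lookup b (lm b)"
        using lm_mult[OF m0 assms] lookup_lm_mult[OF m0 assms] by (simp_all only: lkm)
      then have top: "Poly_Mapping.lookup (a - m * b) (lm a) = 0"
        using nz by (simp add: lookup_minus lkmb c_def)
      have "\<exists>q. (a - m * b) - q * b = 0 \<or>
        \<not> (\<forall>v. Poly_Mapping.lookup (lm b) v \<le> Poly_Mapping.lookup (lm ((a - m * b) - q * b)) v)"
      proof (cases "a - m * b = 0")
        case True
        then show ?thesis by (intro exI[of _ 0]) auto
      next
        case False
        have "lm (a - m * b) \<in> Poly_Mapping.keys a \<union> Poly_Mapping.keys (m * b)"
          using lm_in_keys[OF False] keys_diff[of a "m * b"] by blast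
        then have "ord (lm (a - m * b)) \<le> ord (lm a)"
          using ord_le_lm[of "lm (a - m * b)" a] ord_le_lm[of "lm (a - m * b)" "m * b"]
          unfolding lmmb by blast
        moreover have "lm (a - m * b) \<noteq> lm a"
          using top lm_in_keys[OF False] by (auto simp: in_keys_iff)
        ultimately have "ord (lm (a - m * b)) < ord (lm a)"
          using inj_ord by (auto simp: le_less dest: injD)
        then show ?thesis by (rule less)
      qed
      then obtain q where "(a - m * b) - q * b = 0 \<or>
        \<not> (\<forall>v. Poly_Mapping.lookup (lm b) v \<le> Poly_Mapping.lookup (lm ((a - m * b) - q * b)) v)" ..
      moreover have "(a - m * b) - q * b = a - (m + q) * b" by (simp add: algebra_simps)
      ultimately show ?thesis by (intro exI[of _ "m + q"]) simp
    qed
  qed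
  then obtain q where "a - q * b = 0 \<or>
    \<not> (\<forall>v. Poly_Mapping.lookup (lm b) v \<le> Poly_Mapping.lookup (lm (a - q * b)) v)" ..
  then show ?thesis by (rule that)
qed

text \<open>By the binomial theorem the hypothesis passes to the remainder \<open>r\<close> of
  \<open>a\<close> modulo \<open>b\<close>. If \<open>r\<close> were nonzero, comparing exponents of
  leading monomials for large \<open>n\<close> would make \<open>lm b\<close> divide
  \<open>lm r\<close>.\<close>

lemma completely_integrally_closed:
  fixes a b d :: "('v, 'k::field) mpoly"
  assumes b: "b \<noteq> 0" and d: "d \<noteq> 0" and dvd: "\<And>n. b ^ n dvd d * a ^ n"
  shows "b dvd a"
proof -
  obtain q where q: "a - q * b = 0 \<or>
    \<not> (\<forall>v. Poly_Mapping.lookup (lm b) v \<le> Poly_Mapping.lookup (lm (a - q * b)) v)"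
    by (rule division[OF b])
  define r where "r = a - q * b"
  have dvd_r: "b ^ n dvd d * r ^ n" for n
  proof -
    have r: "r = a + (- q) * b" by (simp add: r_def)
    have "d * r ^ n = (\<Sum>k\<le>n. d * (of_nat (n choose k) * a ^ k * ((- q) * b) ^ (n - k)))"
      unfolding r binomial_ring by (rule sum_distrib_left)
    also have "b ^ n dvd \<dots>"
    proof (rule dvd_sum)
      fix k assume k: "k \<in> {..n}"
      have "b ^ k * b ^ (n - k) dvd (d * a ^ k) * ((- q) * b) ^ (n - k)"
        by (intro mult_dvd_mono dvd dvd_power_same dvd_triv_right)
      moreover have "b ^ k * b ^ (n - k) = b ^ n" using k by (simp flip: power_add)
      ultimately have "b ^ n dvd of_nat (n choose k) * ((d * a ^ k) * ((- q) * b) ^ (n - k))"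
        by (simp only: dvd_mult)
      then show "b ^ n dvd d * (of_nat (n choose k) * a ^ k * ((- q) * b) ^ (n - k))"
        by (simp only: mult_ac)
    qed
    finally show ?thesis .
  qed
  have "r = 0"
  proof (rule ccontr)
    assume r0: "r \<noteq> 0"
    have "Poly_Mapping.lookup (lm b) v \<le> Poly_Mapping.lookup (lm r) v" for v
    proof -
      \<comment> \<open>With \<open>n\<close> larger than the exponent of \<open>v\<close> in
        \<open>lm d\<close>, the contribution of \<open>d\<close> is less than one unit after
        division by \<open>n\<close>.\<close>
      define n where "n = Suc (Poly_Mapping.lookup (lm d) v)"
      obtain e where e: "d * r ^ n = b ^ n * e" using dvd_r[of n] by (elim dvdE)
      have "d * r ^ n \<noteq> 0" by (intro mult_nonzero d power_nonzero r0)
      then have e0: "e \<noteq> 0" using e by auto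
      have "lm d + lm (r ^ n) = lm (b ^ n) + lm e"
        unfolding lm_mult[OF d power_nonzero[OF r0], symmetric] e by (rule lm_mult[OF power_nonzero[OF b] e0])
      then have "Poly_Mapping.lookup (lm d + lm (r ^ n)) v = Poly_Mapping.lookup (lm (b ^ n) + lm e) v"
        by simp
      then have "n * Poly_Mapping.lookup (lm b) v \<le> Poly_Mapping.lookup (lm d) v + n * Poly_Mapping.lookup (lm r) v"
        by (simp add: lookup_add lookup_lm_power r0 b)
      also have "\<dots> < n * Suc (Poly_Mapping.lookup (lm r) v)" by (simp add: n_def)
      finally show ?thesis by (simp only: mult_less_cancel1 less_Suc_eq_le)
    qed
    then show False using q r0 by (simp add: r_def)
  qed
  then show ?thesis by (auto simp: r_def)
qed

end

section \<open>Elimination orders, separating weights and restriction of monomials\<close>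

lemma inj_primes: obtains q :: "'v::finite \<Rightarrow> nat" where "inj q" "\<And>v. prime (q v)"
proof -
  obtain P where P: "P \<subseteq> {p::nat. prime p}" "finite P" "card P = card (UNIV :: 'v set)"
    using infinite_arbitrarily_large[OF primes_infinite] by metis
  then obtain q :: "'v \<Rightarrow> nat" where "bij_betw q UNIV P"
    using finite_same_card_bij[of "UNIV :: 'v set" P] by auto
  then show ?thesis using that[of q] P(1) by (auto simp: bij_betw_def)
qed

definition deg_in :: "'v::finite set \<Rightarrow> ('v \<Rightarrow>\<^sub>0 nat) \<Rightarrow> nat" where
  "deg_in S t = (\<Sum>v\<in>S. Poly_Mapping.lookup t v)"

lemma deg_in_eq_0_iff: "deg_in S t = 0 \<longleftrightarrow> Poly_Mapping.keys t \<subseteq> - S"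
  by (auto simp: deg_in_def in_keys_iff)

lemma deg_in_add: "deg_in S (s + t) = deg_in S s + deg_in S t"
  by (simp add: deg_in_def lookup_add sum.distrib)

text \<open>Monomials are encoded injectively and multiplicatively by products of prime powers, which
  makes the usual order of natural numbers a monomial order.\<close>

lemma elimination_order:
  obtains ord :: "('v::finite \<Rightarrow>\<^sub>0 nat) \<Rightarrow> nat \<times> nat"
  where "monomial_order ord" "\<And>t. fst (ord t) = deg_in S t"
proof -
  obtain q :: "'v \<Rightarrow> nat" where q: "inj q" "\<And>v. prime (q v)" using inj_primes by blast
  define code where "code t = (\<Prod>v\<in>UNIV. q v ^ Poly_Mapping.lookup t v)" for t
  have code_add: "code (s + t) = code s * code t" for s t
    by (simp add: code_def lookup_add power_add prod.distrib)
  have code_pos: "code t > 0" for t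
    unfolding code_def using q(2) by (auto intro!: prod_pos simp: prime_gt_0_nat)
  have mult: "multiplicity (q v) (code t) = Poly_Mapping.lookup t v" for v t
  proof -
    have "code t = (\<Prod>p\<in>range q. p ^ Poly_Mapping.lookup t (inv q p))"
      unfolding code_def by (subst prod.reindex) (use q(1) in auto)
    moreover have "multiplicity (q v) \<dots> = (if q v \<in> range q then Poly_Mapping.lookup t (inv q (q v)) else 0)"
      using q(2) by (intro multiplicity_prod_prime_powers) auto
    ultimately show ?thesis using q(1) by simp
  qed
  have "inj code"
    by (rule injI, rule poly_mapping_eqI) (metis mult)
  define ord where "ord t = (deg_in S t, code t)" for t
  have "monomial_order ord"
  proof
    show "inj ord" using \<open>inj code\<close> by (auto simp: inj_def ord_def)
    show "ord (s + u) < ord (t + u)" if "ord s < ord t" for s t u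
      using that code_pos by (auto simp: ord_def less_prod_def deg_in_add code_add)
  qed
  then show ?thesis using that by (simp add: ord_def)
qed

text \<open>A Kronecker substitution: \<open>v\<close> gets weight \<open>N ^ e v\<close>. Two
  monomials of \<open>D\<close> collide only if \<open>N\<close> is a root of their difference
  polynomial \<open>P s t\<close>, and finitely many such roots are to be avoided.\<close>

lemma separating_weights:
  fixes D :: "('v::finite \<Rightarrow>\<^sub>0 nat) set"
  assumes "finite D"
  obtains w :: "('v \<Rightarrow>\<^sub>0 nat) \<Rightarrow> nat" where "inj_on w D" "w 0 = 0" "\<And>s t. w (s + t) = w s + w t"
proof -
  obtain e :: "'v \<Rightarrow> nat" where e: "inj e" using finite_imp_inj_to_nat_seg[of "UNIV :: 'v set"] by auto
  define P where "P s t = (\<Sum>v\<in>UNIV. monom (int (Poly_Mapping.lookup s v) - int (Poly_Mapping.lookup t v)) (e v))"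
    for s t
  have P: "P s t \<noteq> 0" if "s \<noteq> t" for s t
  proof
    assume "P s t = 0"
    then have "coeff (P s t) (e v) = 0" for v by simp
    moreover have "coeff (P s t) (e v) = int (Poly_Mapping.lookup s v) - int (Poly_Mapping.lookup t v)" for v
      unfolding P_def using e by (simp add: coeff_sum coeff_monom inj_eq)
    ultimately have "s = t" by (intro poly_mapping_eqI) simp
    then show False using that by simp
  qed
  have "finite (\<Union>s\<in>D. \<Union>t\<in>D - {s}. {x. poly (P s t) x = 0})"
    using assms P by (intro finite_UN_I) (auto intro!: poly_roots_finite)
  moreover have "infinite (range int)" by (simp add: finite_image_iff)
  ultimately obtain N where N: "int N \<notin> (\<Union>s\<in>D. \<Union>t\<in>D - {s}. {x. poly (P s t) x = 0})"
    by (metis (no_types, lifting) finite_subset image_subsetI)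
  define w where "w t = (\<Sum>v\<in>UNIV. Poly_Mapping.lookup t v * N ^ e v)" for t
  have wP: "int (w s) - int (w t) = poly (P s t) (int N)" for s t
    by (simp add: w_def P_def poly_sum poly_monom left_diff_distrib sum_subtractf)
  have "inj_on w D"
  proof (rule inj_onI)
    fix s t assume st: "s \<in> D" "t \<in> D" "w s = w t"
    then have "poly (P s t) (int N) = 0" using wP[of s t] by simp
    then show "s = t" using N st by blast
  qed
  moreover have "w (s + t) = w s + w t" for s t
    by (simp add: w_def lookup_add distrib_right sum.distrib)
  ultimately show ?thesis using that by (simp add: w_def)
qed

definition restr :: "'v::finite set \<Rightarrow> ('v \<Rightarrow>\<^sub>0 nat) \<Rightarrow> ('v \<Rightarrow>\<^sub>0 nat)" where
  "restr S t = Abs_poly_mapping (\<lambda>v. if v \<in> S then Poly_Mapping.lookup t v else 0)"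

lemma lookup_restr [simp]: "Poly_Mapping.lookup (restr S t) v = (if v \<in> S then Poly_Mapping.lookup t v else 0)"
  by (simp add: restr_def)

lemma restr_add: "restr S (s + t) = restr S s + restr S t"
  by (rule poly_mapping_eqI) (simp add: lookup_add)

lemma restr_0 [simp]: "restr S 0 = 0"
  by (rule poly_mapping_eqI) simp

lemma restr_id: "Poly_Mapping.keys t \<subseteq> S \<Longrightarrow> restr S t = t"
  by (rule poly_mapping_eqI) (auto simp: in_keys_iff)

lemma restr_eq_0: "Poly_Mapping.keys t \<subseteq> - S \<Longrightarrow> restr S t = 0"
  by (rule poly_mapping_eqI) (auto simp: in_keys_iff)

lemma restr_eq_0_iff: "restr S t = 0 \<longleftrightarrow> Poly_Mapping.keys t \<subseteq> - S"
  by (auto simp: poly_mapping_eq_iff fun_eq_iff in_keys_iff)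

lemma restr_eqD: "restr S s = restr S t \<Longrightarrow> restr (- S) s = restr (- S) t \<Longrightarrow> s = t"
  by (rule poly_mapping_eqI) (metis ComplI lookup_restr)

section \<open>Separated multiples\<close>

text \<open>Leading monomials add, so in an order comparing degrees outside \<open>S\<close> first,
  \<open>lm p\<close> has degree 0 there; no monomial of \<open>p\<close> can then have a larger
  one.\<close>

lemma polys_in_dvd:
  fixes p g :: "('v::finite, 'k::field) mpoly"
  assumes "g \<in> polys_in S" "g \<noteq> 0" "p dvd g"
  shows "p \<in> polys_in S"
proof -
  obtain ord :: "('v \<Rightarrow>\<^sub>0 nat) \<Rightarrow> nat \<times> nat"
    where ord: "monomial_order ord" "\<And>t. fst (ord t) = deg_in (- S) t"
    using elimination_order by blast
  interpret monomial_order ord by (rule ord)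
  obtain r where r: "g = p * r" using assms(3) by (elim dvdE)
  then have nz: "p \<noteq> 0" "r \<noteq> 0" using assms(2) by auto
  have "deg_in (- S) (lm g) = 0"
    using assms(1) lm_in_keys[OF assms(2)] by (simp add: deg_in_eq_0_iff polys_in_iff)
  then have 0: "deg_in (- S) (lm p) = 0"
    by (simp add: r lm_mult[OF nz] deg_in_add)
  have "deg_in (- S) t = 0" if "t \<in> Poly_Mapping.keys p" for t
    using ord_le_lm[OF that] 0 ord(2)[of t] ord(2)[of "lm p"] by (simp add: less_eq_prod_def)
  then show ?thesis by (simp add: polys_in_iff deg_in_eq_0_iff)
qed

lemma polys_in_cofactor:
  fixes b q :: "('v::finite, 'k::field) mpoly"
  assumes "b * q \<in> polys_in S" "b \<noteq> 0"
  shows "q \<in> polys_in S"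
proof (cases "q = 0")
  case False
  obtain ord :: "('v \<Rightarrow>\<^sub>0 nat) \<Rightarrow> nat \<times> nat" where "monomial_order ord"
    using elimination_order by blast
  then interpret monomial_order ord .
  show ?thesis using polys_in_dvd[OF assms(1) mult_nonzero[OF assms(2) False]] by simp
qed simp

text \<open>Modulo \<open>b\<close>, the leading coefficient of \<open>f - g\<close>, as a polynomial in the variables outside
  \<open>S\<close>, is a nonzero constant.\<close>

lemma dvd_mult_separated_cancel:
  fixes b s f g :: "('v::finite, 'k::field) mpoly"
  assumes f: "f \<in> polys_in S" and g: "g \<in> polys_in (- S)" "g \<notin> polys_in S"
    and b: "b \<in> polys_in S" "b \<noteq> 0" and dvd: "b dvd (f - g) * s"
  shows "b dvd s"
proof -
  obtain ord :: "('v \<Rightarrow>\<^sub>0 nat) \<Rightarrow> nat \<times> nat"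
    where ord: "monomial_order ord" "\<And>t. fst (ord t) = deg_in (- S) t"
    using elimination_order by blast
  interpret monomial_order ord by (rule ord)
  obtain t where t: "t \<in> Poly_Mapping.keys g" "\<not> Poly_Mapping.keys t \<subseteq> S"
    using g(2) by (auto simp: polys_in_iff)
  have "t \<notin> Poly_Mapping.keys f" using t(2) f by (auto simp: polys_in_iff)
  then have tF: "t \<in> Poly_Mapping.keys (f - g)" using t(1) by (simp add: in_keys_iff lookup_minus)
  then have F0: "f - g \<noteq> 0" by auto
  have "deg_in (- S) t > 0" using t(2) deg_in_eq_0_iff[of "- S" t] by simp
  then have "deg_in (- S) (lm (f - g)) > 0"
    using ord_le_lm[OF tF] ord(2)[of t] ord(2)[of "lm (f - g)"] by (auto simp: less_eq_prod_def)
  then have "\<not> Poly_Mapping.keys (lm (f - g)) \<subseteq> S"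
    using deg_in_eq_0_iff[of "- S" "lm (f - g)"] by simp
  then have "lm (f - g) \<notin> Poly_Mapping.keys f" using f unfolding polys_in_iff by blast
  then have "lm (f - g) \<in> Poly_Mapping.keys g" using lm_in_keys[OF F0] keys_diff[of f g] by blast
  then have lmF: "Poly_Mapping.keys (lm (f - g)) \<subseteq> - S" using g(1) by (auto simp: polys_in_iff)
  have lmb: "Poly_Mapping.keys (lm b) \<subseteq> S"
    using b(1) lm_in_keys[OF b(2)] by (auto simp: polys_in_iff)
  obtain q where q: "s - q * b = 0 \<or>
    \<not> (\<forall>v. Poly_Mapping.lookup (lm b) v \<le> Poly_Mapping.lookup (lm (s - q * b)) v)"
    by (rule division[OF b(2)])
  define r where "r = s - q * b"
  have "b dvd (f - g) * r"
    unfolding r_def right_diff_distrib using dvd by (intro dvd_diff) auto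
  then obtain z where z: "(f - g) * r = b * z" by (elim dvdE)
  have "r = 0"
  proof (rule ccontr)
    assume r0: "r \<noteq> 0"
    then have z0: "z \<noteq> 0" using z mult_nonzero[OF F0 r0] by auto
    have eq: "lm (f - g) + lm r = lm b + lm z"
      unfolding lm_mult[OF F0 r0, symmetric] z by (rule lm_mult[OF b(2) z0])
    \<comment> \<open>In a variable of \<open>S\<close>, \<open>lm (f - g)\<close> contributes
      nothing to \<open>eq\<close>; outside \<open>S\<close>, \<open>lm b\<close> has exponent
      0.\<close>
    have "Poly_Mapping.lookup (lm b) v \<le> Poly_Mapping.lookup (lm r) v" for v
    proof (cases "v \<in> S")
      case True
      then have "v \<notin> Poly_Mapping.keys (lm (f - g))" using lmF by blast
      then have "Poly_Mapping.lookup (lm (f - g)) v = 0" by (simp add: in_keys_iff)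
      then have "Poly_Mapping.lookup (lm r) v = Poly_Mapping.lookup (lm b) v + Poly_Mapping.lookup (lm z) v"
        using arg_cong[OF eq, of "\<lambda>t. Poly_Mapping.lookup t v"] by (simp add: lookup_add)
      then show ?thesis by simp
    next
      case False
      then have "v \<notin> Poly_Mapping.keys (lm b)" using lmb by blast
      then show ?thesis by (simp add: in_keys_iff)
    qed
    then show False using q r0 by (simp add: r_def)
  qed
  then show ?thesis by (simp add: r_def)
qed

section \<open>The algebra of separated multiples for a variable set and its complement\<close>

locale separated =
  fixes p :: "('v::finite, 'k::field) mpoly" and S :: "'v set"
  assumes p_notin: "p \<notin> polys_in S" "p \<notin> polys_in (- S)"
begin

definition A :: "(('v, 'k) mpoly \<times> ('v, 'k) mpoly) set" where
  "A = {(f, g). f \<in> polys_in S \<and> g \<in> polys_in (- S) \<and> p dvd f - g}"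

lemma A_const: "(const c, const c) \<in> A"
  by (simp add: A_def polys_in_const)

lemma A_add: "(f, g) \<in> A \<Longrightarrow> (f', g') \<in> A \<Longrightarrow> (f + f', g + g') \<in> A"
  by (auto simp: A_def polys_in_add add_diff_add intro: dvd_add)

lemma A_mult:
  assumes "(f, g) \<in> A" "(f', g') \<in> A"
  shows "(f * f', g * g') \<in> A"
proof -
  have eq: "f * f' - g * g' = f * (f' - g') + g' * (f - g)" by (simp add: algebra_simps)
  have "p dvd f * f' - g * g'"
    unfolding eq using assms by (intro dvd_add dvd_mult) (auto simp: A_def)
  then show ?thesis using assms by (simp add: A_def polys_in_mult)
qed

lemma A_diff: "(f, g) \<in> A \<Longrightarrow> (f', g') \<in> A \<Longrightarrow> (f - f', g - g') \<in> A"
  using A_add[OF _ A_mult[OF A_const[of "-1"]], of f g f' g'] by (simp add: const_def single_uminus)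

lemma A_power: "(f, g) \<in> A \<Longrightarrow> (f ^ n, g ^ n) \<in> A"
  by (induction n) (use A_const[of 1] A_mult in \<open>auto simp: const_1\<close>)

lemma A_eval_at: "(f, g) \<in> A \<Longrightarrow> (eval_at h f, eval_at h g) \<in> A"
proof (induction h)
  case 0
  then show ?case using A_const[of 0] by simp
next
  case (pCons a h)
  then show ?case by (simp add: eval_at_pCons A_add A_const A_mult)
qed

text \<open>If one component is 0, then \<open>p\<close> divides the other; were that one nonzero,
  \<open>polys_in_dvd\<close> would put \<open>p\<close> among the polynomials on one side.\<close>

lemma A_eq_0_iff:
  assumes "(f, g) \<in> A"
  shows "f = 0 \<longleftrightarrow> g = 0"
proof
  assume "f = 0"
  then show "g = 0" using assms p_notin(2) polys_in_dvd[of g "- S" p] by (auto simp: A_def)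
next
  assume "g = 0"
  then show "f = 0" using assms p_notin(1) polys_in_dvd[of f S p] by (auto simp: A_def)
qed

text \<open>The variables in \<open>S\<close> are replaced by powers of a single one, chosen such that the monomials
  of \<open>p\<close> are kept apart. The image of \<open>p\<close> then still involves that variable, and so the
  argument for \<open>A_eq_0_iff\<close> applies to it.\<close>

lemma univariate_specialization:
  obtains \<psi> :: "('v, 'k) mpoly \<Rightarrow> 'k poly"
  where "\<And>f g. \<psi> (f + g) = \<psi> f + \<psi> g" "\<And>f g. \<psi> (f - g) = \<psi> f - \<psi> g"
    "\<And>f g. \<psi> (f * g) = \<psi> f * \<psi> g" "\<And>c. \<psi> (const c) = [:c:]"
    "\<And>f g. (f, g) \<in> A \<Longrightarrow> \<psi> f = 0 \<Longrightarrow> f = 0"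
proof -
  \<comment> \<open>Including 0 guarantees a positive weight for every monomial of \<open>p\<close>
    that involves \<open>S\<close>.\<close>
  obtain w0 :: "('v \<Rightarrow>\<^sub>0 nat) \<Rightarrow> nat" where w0: "inj_on w0 (insert 0 (restr S ` Poly_Mapping.keys p))"
    "w0 0 = 0" "\<And>s t. w0 (s + t) = w0 s + w0 t"
    using separating_weights[of "insert 0 (restr S ` Poly_Mapping.keys p)"] by auto
  define w where "w t = w0 (restr S t)" for t
  have w_add: "w (s + t) = w s + w t" for s t by (simp add: w_def restr_add w0(3))
  have w_0: "w 0 = 0" by (simp add: w_def w0(2))
  obtain t0 where t0: "t0 \<in> Poly_Mapping.keys p" "\<not> Poly_Mapping.keys t0 \<subseteq> - S"
    using p_notin(2) by (auto simp: polys_in_iff)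
  then obtain x where x: "x \<in> S" by auto
  define \<mu> where "\<mu> t = Poly_Mapping.single x (w t) + restr (- S) t" for t
  have \<mu>_add: "\<mu> (s + t) = \<mu> s + \<mu> t" for s t
    by (simp add: \<mu>_def w_add restr_add single_add add_ac)
  have \<mu>_0: "\<mu> 0 = 0" by (simp add: \<mu>_def w_0)
  have restr_\<mu>: "restr (- S) (\<mu> t) = restr (- S) t" for t
    unfolding \<mu>_def by (rule poly_mapping_eqI) (use x in \<open>auto simp: lookup_add lookup_single when_def\<close>)
  have \<mu>_x: "Poly_Mapping.lookup (\<mu> t) x = w t" for t
    using x by (simp add: \<mu>_def lookup_add)
  have \<mu>_inj: "s = t" if "s \<in> Poly_Mapping.keys p" "t \<in> Poly_Mapping.keys p" "\<mu> s = \<mu> t" for s t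
  proof (rule restr_eqD[of S])
    show "restr (- S) s = restr (- S) t" using that(3) restr_\<mu> by metis
    have "w s = w t" using that(3) \<mu>_x by metis
    then show "restr S s = restr S t" using w0(1) that(1,2) by (auto simp: w_def dest: inj_onD)
  qed
  \<comment> \<open>Two versions of the substitution: \<open>u.ext\<close> lands in
    \<open>K[t]\<close> and sends variables outside \<open>S\<close> to 1, while
    \<open>m.ext\<close> uses \<open>x\<close> in place of t and fixes those variables. On
    polynomials in \<open>S\<close> they agree up to renaming t to \<open>x\<close>.\<close>
  interpret u: monomial_hom "\<lambda>c::'k. [:c:]" "\<lambda>t::'v \<Rightarrow>\<^sub>0 nat. monom 1 (w t)"
    by standard (simp_all add: w_add w_0 mult_monom one_pCons)
  interpret m: monomial_hom "const :: 'k \<Rightarrow> ('v, 'k) mpoly" "\<lambda>t. Poly_Mapping.single (\<mu> t) 1"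
    by standard (simp_all add: const_add const_mult const_1 \<mu>_add mult_single \<mu>_0)
  have m_eq: "m.ext f = eval_at (u.ext f) (Poly_Mapping.single (Poly_Mapping.single x 1) 1)"
    if "f \<in> polys_in S" for f
  proof -
    have pow: "Poly_Mapping.single (Poly_Mapping.single x 1) (1::'k) ^ n
        = Poly_Mapping.single (Poly_Mapping.single x n) 1" for n
      by (induction n) (simp_all add: mult_single flip: single_add)
    have "eval_at (u.ext f) (Poly_Mapping.single (Poly_Mapping.single x 1) 1)
        = (\<Sum>t\<in>Poly_Mapping.keys f. const (Poly_Mapping.lookup f t) * Poly_Mapping.single (Poly_Mapping.single x (w t)) 1)"
      by (simp add: u.ext_def eval_at_sum eval_at_smult eval_at_monom pow[unfolded One_nat_def] const_1)
    also have "\<dots> = m.ext f"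
      unfolding m.ext_def
    proof (intro sum.cong refl)
      fix t assume "t \<in> Poly_Mapping.keys f"
      then have "Poly_Mapping.keys t \<subseteq> - (- S)" using that by (auto simp: polys_in_iff)
      then have "restr (- S) t = 0" by (rule restr_eq_0)
      then show "const (Poly_Mapping.lookup f t) * Poly_Mapping.single (Poly_Mapping.single x (w t)) 1
          = const (Poly_Mapping.lookup f t) * Poly_Mapping.single (\<mu> t) 1" by (simp add: \<mu>_def)
    qed
    finally show ?thesis by simp
  qed
  have m_id: "m.ext g = g" if "g \<in> polys_in (- S)" for g
  proof -
    have "m.ext g = (\<Sum>t\<in>Poly_Mapping.keys g. Poly_Mapping.single t (Poly_Mapping.lookup g t))"
      unfolding m.ext_def
    proof (intro sum.cong refl)
      fix t assume "t \<in> Poly_Mapping.keys g"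
      then have "Poly_Mapping.keys t \<subseteq> - S" using that by (auto simp: polys_in_iff)
      then have "\<mu> t = t" by (simp add: \<mu>_def w_def restr_eq_0 restr_id w0(2))
      then show "const (Poly_Mapping.lookup g t) * Poly_Mapping.single (\<mu> t) 1
          = Poly_Mapping.single t (Poly_Mapping.lookup g t)" by (simp add: const_def mult_single)
    qed
    then show ?thesis by (simp add: sum_monomials)
  qed
  have m_p: "m.ext p \<notin> polys_in (- S)"
  proof -
    have "Poly_Mapping.lookup (m.ext p) (\<mu> t0)
        = (\<Sum>t\<in>Poly_Mapping.keys p. Poly_Mapping.lookup p t when \<mu> t = \<mu> t0)"
      by (simp add: m.ext_def lookup_sum const_def mult_single lookup_single)
    also have "\<dots> = (\<Sum>t\<in>Poly_Mapping.keys p. if t = t0 then Poly_Mapping.lookup p t else 0)"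
      by (intro sum.cong refl) (use \<mu>_inj[OF _ t0(1)] in \<open>auto simp: when_def\<close>)
    also have "\<dots> = Poly_Mapping.lookup p t0" using t0(1) by simp
    finally have "\<mu> t0 \<in> Poly_Mapping.keys (m.ext p)" using t0(1) by (simp add: in_keys_iff)
    moreover have "w t0 \<noteq> 0"
    proof
      assume "w t0 = 0"
      then have "w0 (restr S t0) = w0 0" by (simp add: w_def w0(2))
      then have "restr S t0 = 0" by (rule inj_onD[OF w0(1)]) (use t0(1) in auto)
      then show False using t0(2) restr_eq_0_iff by blast
    qed
    then have "x \<in> Poly_Mapping.keys (\<mu> t0)" using \<mu>_x by (simp add: in_keys_iff)
    ultimately show ?thesis using x by (auto simp: polys_in_iff)
  qed
  have inj: "f = 0" if fg: "(f, g) \<in> A" and "u.ext f = 0" for f g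
  proof -
    have "m.ext f = 0" using m_eq[of f] that by (simp add: A_def)
    moreover have "m.ext p dvd m.ext (f - g)" using fg by (intro m.ext_dvd) (simp add: A_def)
    ultimately have "m.ext p dvd g" using fg m_id[of g] by (simp add: A_def m.ext_diff)
    then have "g = 0" using m_p polys_in_dvd[of g "- S" "m.ext p"] fg by (auto simp: A_def)
    then show ?thesis using A_eq_0_iff[OF fg] by simp
  qed
  show ?thesis
    by (rule that[of u.ext]) (simp_all add: u.ext_add u.ext_diff u.ext_mult u.ext_const inj)
qed

lemma simple_A: "\<exists>(f, g)\<in>A. \<forall>(u, v)\<in>A. \<exists>h. u = eval_at h f \<and> v = eval_at h g"
proof -
  obtain \<psi> :: "('v, 'k) mpoly \<Rightarrow> 'k poly" where \<psi>:
    "\<And>f g. \<psi> (f + g) = \<psi> f + \<psi> g" "\<And>f g. \<psi> (f - g) = \<psi> f - \<psi> g"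
    "\<And>f g. \<psi> (f * g) = \<psi> f * \<psi> g" "\<And>c. \<psi> (const c) = [:c:]"
    and \<psi>_0: "\<And>f g. (f, g) \<in> A \<Longrightarrow> \<psi> f = 0 \<Longrightarrow> f = 0"
    by (rule univariate_specialization) blast
  have \<psi>_pow: "\<psi> (f ^ n) = \<psi> f ^ n" for f n
    by (induction n) (use \<psi>(4)[of 1] in \<open>simp_all add: \<psi>(3) const_1 one_pCons\<close>)
  have \<psi>_eval: "\<psi> (eval_at h f) = pcompose h (\<psi> f)" for h f
    by (induction h) (use \<psi>(4)[of 0] in \<open>simp_all add: eval_at_pCons pcompose_pCons \<psi>\<close>)
  have \<psi>_inj: "f = f' \<and> g = g'" if "(f, g) \<in> A" "(f', g') \<in> A" "\<psi> f = \<psi> f'" for f g f' g'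
  proof -
    have d: "(f - f', g - g') \<in> A" using that by (intro A_diff)
    moreover have "f - f' = 0" using \<psi>_0[OF d] that(3) by (simp add: \<psi>(2))
    ultimately show ?thesis using A_eq_0_iff[OF d] by simp
  qed
  define B where "B = \<psi> ` fst ` A"
  have B_iff: "b \<in> B \<longleftrightarrow> (\<exists>f g. (f, g) \<in> A \<and> \<psi> f = b)" for b
    by (force simp: B_def)
  interpret B: poly_subalgebra B
  proof
    show "[:c:] \<in> B" for c using A_const[of c] \<psi>(4)[of c] unfolding B_iff by blast
    show "a + b \<in> B" "a * b \<in> B" if "a \<in> B" "b \<in> B" for a b
      using that A_add A_mult \<psi>(1,3) unfolding B_iff by metis+
  qed
  show ?thesis
  proof (cases "\<exists>(f, g)\<in>A. degree (\<psi> f) > 0")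
    case False
    \<comment> \<open>Here \<open>A\<close> consists of the constant pairs only, and (0, 0)
      generates it.\<close>
    have "\<exists>h. u = eval_at h 0 \<and> v = eval_at h 0" if uv: "(u, v) \<in> A" for u v
    proof -
      have "degree (\<psi> u) = 0" using False uv by auto
      then have "\<psi> u = \<psi> (const (coeff (\<psi> u) 0))" using \<psi>(4) by (metis degree_0_id)
      then have "u = const (coeff (\<psi> u) 0) \<and> v = const (coeff (\<psi> u) 0)"
        using \<psi>_inj[OF uv A_const] by blast
      then show ?thesis by (intro exI[of _ "[:coeff (\<psi> u) 0:]"]) (simp add: eval_at_pCons)
    qed
    then show ?thesis using A_const[of 0] by (intro bexI[of _ "(0, 0)"]) auto
  next
    case True
    then obtain f0 g0 where fg0: "(f0, g0) \<in> A" "degree (\<psi> f0) > 0" by blast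
    have g0: "g0 \<notin> polys_in S"
    proof
      assume "g0 \<in> polys_in S"
      then obtain c where c: "g0 = const c" using polys_in_disjoint[of g0 S] fg0(1) by (auto simp: A_def)
      have d: "(f0 - const c, g0 - const c) \<in> A" by (intro A_diff fg0 A_const)
      then have "f0 = const c" using A_eq_0_iff[OF d] c by simp
      then show False using fg0(2) \<psi>(4) by simp
    qed
    \<comment> \<open>With f0 - g0 = p r and b u = p s, the product (f0 - g0) s is a multiple of
      \<open>b\<close>; hence \<open>b\<close> divides \<open>s\<close> and cancels from b u = p
      s.\<close>
    have cancel: "p dvd u" if b: "b \<in> polys_in S" "b \<noteq> 0" and dvd: "p dvd b * u" for b u
    proof -
      obtain ord :: "('v \<Rightarrow>\<^sub>0 nat) \<Rightarrow> nat \<times> nat" where "monomial_order ord"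
        using elimination_order by blast
      then interpret monomial_order ord .
      obtain r where r: "f0 - g0 = p * r" using fg0(1) by (auto simp: A_def)
      obtain s where s: "b * u = p * s" using dvd by (elim dvdE)
      have "(f0 - g0) * s = b * (u * r)"
      proof -
        have "(f0 - g0) * s = (p * s) * r" unfolding r by (simp only: mult_ac)
        also have "\<dots> = b * (u * r)" unfolding s[symmetric] by (simp only: mult_ac)
        finally show ?thesis .
      qed
      then have "b dvd (f0 - g0) * s" by simp
      moreover have "f0 \<in> polys_in S" "g0 \<in> polys_in (- S)" using fg0(1) by (auto simp: A_def)
      ultimately have "b dvd s" using dvd_mult_separated_cancel[OF _ _ g0 b] by blast
      then obtain s' where "s = b * s'" by (elim dvdE)
      then have "b * u = b * (p * s')" using s by (simp add: mult_ac)
      then have "u = p * s'" by (rule mult_cancel[OF b(2)])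
      then show ?thesis by simp
    qed
    have w: "\<psi> f0 \<in> B" using fg0(1) unfolding B_iff by blast
    obtain d where d: "d \<in> B" "d \<noteq> 0" "\<And>c. c \<in> B.frac_closure \<Longrightarrow> d * c \<in> B"
      using B.common_denominator[OF w fg0(2)] by blast
    obtain d1 d2 where d12: "(d1, d2) \<in> A" "\<psi> d1 = d" using d(1) unfolding B_iff by blast
    have d1: "d1 \<noteq> 0" using d12(2) d(2) \<psi>(4)[of 0] by auto
    have d2: "d2 \<noteq> 0" using A_eq_0_iff[OF d12(1)] d1 by simp
    interpret C: poly_subalgebra B.frac_closure by (rule B.poly_subalgebra_frac_closure)
    have "B.frac_closure \<subseteq> B"
    proof
      fix c assume c: "c \<in> B.frac_closure"
      then obtain b a where ab: "b \<in> B" "b \<noteq> 0" "b * c = a" "a \<in> B"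
        unfolding B.frac_closure_def by blast
      obtain b1 b2 where b12: "(b1, b2) \<in> A" "\<psi> b1 = b" using ab(1) unfolding B_iff by blast
      obtain a1 a2 where a12: "(a1, a2) \<in> A" "\<psi> a1 = a" using ab(4) unfolding B_iff by blast
      have b1: "b1 \<noteq> 0" using b12(2) ab(2) \<psi>(4)[of 0] by auto
      have b2: "b2 \<noteq> 0" using A_eq_0_iff[OF b12(1)] b1 by simp
      have dvd: "b1 ^ n dvd d1 * a1 ^ n \<and> b2 ^ n dvd d2 * a2 ^ n" for n
      proof -
        have "d * c ^ n \<in> B" by (intro d(3) C.power_closed c)
        then obtain e1 e2 where e: "(e1, e2) \<in> A" "\<psi> e1 = d * c ^ n" unfolding B_iff by blast
        \<comment> \<open>This is b^n (d c^n) = d a^n. Since \<psi> on first components determines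
          the whole pair, the identity lifts to the second components as well.\<close>
        have "\<psi> (b1 ^ n * e1) = \<psi> (d1 * a1 ^ n)"
          by (simp add: \<psi>(3) \<psi>_pow e(2) b12(2) a12(2) d12(2) power_mult_distrib mult_ac flip: ab(3))
        then have "b1 ^ n * e1 = d1 * a1 ^ n \<and> b2 ^ n * e2 = d2 * a2 ^ n"
          by (intro \<psi>_inj A_mult A_power b12(1) a12(1) d12(1) e(1))
        then show ?thesis by (metis dvd_triv_left)
      qed
      obtain ord :: "('v \<Rightarrow>\<^sub>0 nat) \<Rightarrow> nat \<times> nat" where "monomial_order ord"
        using elimination_order by blast
      then interpret monomial_order ord .
      have "b1 dvd a1" by (rule completely_integrally_closed[OF b1 d1]) (use dvd in blast)
      then obtain f where f: "a1 = b1 * f" by (elim dvdE)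
      have "b2 dvd a2" by (rule completely_integrally_closed[OF b2 d2]) (use dvd in blast)
      then obtain g where g: "a2 = b2 * g" by (elim dvdE)
      have fS: "f \<in> polys_in S"
        by (rule polys_in_cofactor[of b1]) (use a12(1) b1 f in \<open>auto simp: A_def\<close>)
      have gS: "g \<in> polys_in (- S)"
        by (rule polys_in_cofactor[of b2]) (use a12(1) b2 g in \<open>auto simp: A_def\<close>)
      \<comment> \<open>The quotients are polynomials on the correct sides; what remains is
        \<open>p dvd f - g\<close>, obtained up to the factor \<open>b1\<close>, which
        \<open>cancel\<close> removes.\<close>
      have eq: "b1 * (f - g) = (a1 - a2) - g * (b1 - b2)" by (simp add: f g algebra_simps)
      have "b1 \<in> polys_in S" "p dvd a1 - a2" "p dvd b1 - b2"
        using a12(1) b12(1) by (auto simp: A_def)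
      then have "p dvd b1 * (f - g)" unfolding eq by (metis dvd_diff dvd_mult)
      then have "p dvd f - g" by (rule cancel[OF \<open>b1 \<in> polys_in S\<close> b1])
      then have "(f, g) \<in> A" using fS gS by (simp add: A_def)
      moreover have "\<psi> f = c"
      proof -
        have "b * \<psi> f = b * c" using a12(2) b12(2) ab(3) f \<psi>(3) by metis
        then show ?thesis using ab(2) by simp
      qed
      ultimately show "c \<in> B" unfolding B_iff by blast
    qed
    from B.generated_by_one[OF w fg0(2) this]
    obtain h where h: "h \<in> B" "\<And>b. b \<in> B \<Longrightarrow> \<exists>q. b = pcompose q h" by blast
    obtain f g where fg: "(f, g) \<in> A" "\<psi> f = h" using h(1) unfolding B_iff by blast
    have "\<exists>q. u = eval_at q f \<and> v = eval_at q g" if uv: "(u, v) \<in> A" for u v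
    proof -
      have "\<psi> u \<in> B" using uv unfolding B_iff by blast
      then obtain q where "\<psi> u = pcompose q h" using h(2) by blast
      then have "\<psi> u = \<psi> (eval_at q f)" by (simp add: \<psi>_eval fg(2))
      then show ?thesis using \<psi>_inj[OF uv A_eval_at[OF fg(1), of q]] by blast
    qed
    then show ?thesis using fg(1) by (intro bexI[of _ "(f, g)"]) auto
  qed
qed

end

theorem corollary9:
  fixes p :: "('n::finite + 'm::finite, 'k::field_char_0) mpoly"
  assumes "p \<notin> polys_X \<union> polys_Y"
  shows "simple_alg (sep_alg (ideal_gen {p}))"
proof -
  \<comment> \<open>The general result speaks of a set of variables and its complement, here X and
    Y.\<close>
  have Y: "- range Inl = (range Inr :: ('n + 'm) set)"
    by (auto, metis obj_sumE rangeI)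
  have eqs: "polys_X = (polys_in (range Inl) :: ('n + 'm, 'k) mpoly set)"
      "polys_Y = (polys_in (- range Inl) :: ('n + 'm, 'k) mpoly set)"
    unfolding polys_X_def polys_Y_def polys_in_def Y by simp_all
  interpret separated p "range Inl"
    by standard (use assms in \<open>auto simp: eqs\<close>)
  have "sep_alg (ideal_gen {p}) = A"
    by (simp add: sep_alg_def A_def ideal_gen_singleton eqs)
  then show ?thesis using simple_A by (simp add: simple_alg_def)
qed

end
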